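(* Let $\mathcal{H}\subseteq\mathcal{B}$, $L:\mathcal{B}\to\mathbb{R}$ and $\nabla L:\mathcal{B}\to\mathcal{B}$ be as in the context, and suppose conditions (Smooth), (Descent), (Compat) and (PL) of the context hold with constants $K,\alpha,\beta,\mu>0$, where $L^\star=\inf_{f'\in\mathcal{H}}L(f')\in\mathbb{R}$. Assume $L(f)\ge L^\star$ for all $f\in\mathcal{B}$. Let $T\ge1$, $\eta>0$, $f_0\in\mathcal{B}$, $g_0,\dots,g_{T-1}\in\mathcal{B}$ and $f_{t+1}=f_t-\eta g_t$ for $t=0,\dots,T-1$. Assume that for some constant $0\le\epsilon<\min\{1/2,\ \alpha/(\alpha+\beta)\}$, $$\mathrm{RelErr}(g_t,\nabla L(f_t))\le\epsilon\qquad\text{for all }t=0,\dots,T-1 .$$ Then, for any learning rate $\eta<\dfrac{2(\alpha-(\alpha+\beta)\epsilon)}{K(2\epsilon+1)}$, $$L(f_T)-L^\star\le\bigl[1-2\eta\beta^{-2}\mu r\bigr]^T\bigl(L(f_0)-L^\star\bigr),\qquad\text{where } r:=\alpha-\frac{K\eta}{2}-\Bigl(\beta+\frac32K\eta\Bigr)\frac{\epsilon}{1-\epsilon}>0 .$$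
   Context: $\mathcal{H}$ is a real Hilbert space contained (as a linear subspace) in a real Banach space $\mathcal{B}$, with dual $\mathcal{B}^*$ and dual norm $\lVert u\rVert_{\mathcal{B}^*}=\sup_{\lVert b\rVert_{\mathcal{B}}\le1}|u(b)|$. One is given a Fréchet differentiable loss on $\mathcal{H}$, with Riesz gradient operator $\mathcal{H}\to\mathcal{H}$ characterized by: the derivative at $f$ in direction $v$ equals $\langle \nabla L(f),v\rangle_{\mathcal{H}}$ for all $v\in\mathcal{H}$. It is assumed that the loss extends to a Fréchet differentiable functional $L:\mathcal{B}\to\mathbb{R}$, and that the gradient operator extends to an operator $\nabla L:\mathcal{B}\to\mathcal{B}$ (each extension agrees with the original on $\mathcal{H}$; the same symbols are used for the extensions). $\mathrm{D}L(f;v)$ denotes the derivative of the extended $L$ at $f\in\mathcal{B}$ in direction $v\in\mathcal{B}$, and $\mathrm{D}L(f;\cdot)\in\mathcal{B}^*$. Relative error: $\mathrm{RelErr}(g,\nabla L(f)):=\lVert g-\nabla L(f)\rVert_{\mathcal{B}}/\lVert g\rVert_{\mathcal{B}}$, with conventions $0/0=0$ and $a/0=+\infty$ for $a>0$. The conditions referred to (with constants $K,\alpha,\beta,\mu>0$): - (Smooth) $L(f)\le L(f')+\mathrm{D}L(f';f-f')+\frac K2\lVert f-f'\rVert_{\mathcal{B}}^2$ for all $f,f'\in\mathcal{B}$. - (Descent) $\mathrm{D}L(f;\nabla L(f))\ge\alpha\lVert\nabla L(f)\rVert_{\mathcal{B}}^2$ for all $f\in\mathcal{B}$. - (Compat)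 $\lVert\mathrm{D}L(f;\cdot)\rVert_{\mathcal{B}^*}\le\beta\lVert\nabla L(f)\rVert_{\mathcal{B}}$ for all $f\in\mathcal{B}$. - (PL) $L(f)-L^\star\le\frac1{2\mu}\lVert\mathrm{D}L(f;\cdot)\rVert_{\mathcal{B}^*}^2$ for all $f\in\mathcal{B}$, where $L^\star=\inf_{f'\in\mathcal{H}}L(f')$. *)

theory Defs
  imports "HOL-Analysis.Analysis"
begin

text \<open>The dual norm of a continuous linear functional is rendered as \<open>onorm\<close>; the following
  fact records that this is the supremum over the closed unit ball.\<close>

lemma onorm_eq_SUP_cball:
  fixes u :: "'b::real_normed_vector \<Rightarrow> real"
  assumes u: "bounded_linear u"
  shows "onorm u = (SUP b\<in>cball 0 1. \<bar>u b\<bar>)"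
proof (rule antisym)
  have le: "\<bar>u b\<bar> \<le> onorm u" if "b \<in> cball 0 1" for b
  proof -
    have "\<bar>u b\<bar> \<le> onorm u * norm b"
      using onorm[OF u, of b] by simp
    also have "\<dots> \<le> onorm u * 1"
      using that onorm_pos_le[OF u] by (intro mult_left_mono) auto
    finally show ?thesis by simp
  qed
  then show "(SUP b\<in>cball 0 1. \<bar>u b\<bar>) \<le> onorm u"
    by (intro cSUP_least) auto
  have bdd: "bdd_above ((\<lambda>b. \<bar>u b\<bar>) ` cball 0 1)"
    using le by (auto intro!: bdd_aboveI)
  have "norm (u x) / norm x \<le> (SUP b\<in>cball 0 1. \<bar>u b\<bar>)" for x
  proof -
    have "u (x /\<^sub>R norm x) = u x / norm x"
      using linear_cmul[OF bounded_linear.linear[OF u]] by (simp add: divide_inverse_commute)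
    then have "norm (u x) / norm x = \<bar>u (x /\<^sub>R norm x)\<bar>"
      by simp
    also have "\<dots> \<le> (SUP b\<in>cball 0 1. \<bar>u b\<bar>)"
      by (intro cSUP_upper bdd) (cases "x = 0"; simp)
    finally show ?thesis .
  qed
  then show "onorm u \<le> (SUP b\<in>cball 0 1. \<bar>u b\<bar>)"
    unfolding onorm_def by (intro cSUP_least) auto
qed

definition rel_err :: "'b::real_normed_vector \<Rightarrow> 'b \<Rightarrow> ereal" where
  "rel_err g d =
     (if g = 0 then (if d = 0 then 0 else \<infinity>) else ereal (norm (g - d) / norm g))"

abbreviation D_loss :: "('b::real_normed_vector \<Rightarrow> real) \<Rightarrow> 'b \<Rightarrow> 'b \<Rightarrow> real" where
  "D_loss L f \<equiv> frechet_derivative L (at f)"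

definition smooth_cond :: "('b::real_normed_vector \<Rightarrow> real) \<Rightarrow> real \<Rightarrow> bool" where
  "smooth_cond L K \<longleftrightarrow>
     (\<forall>f f'. L f \<le> L f' + D_loss L f' (f - f') + K / 2 * (norm (f - f'))\<^sup>2)"

definition descent_cond ::
  "('b::real_normed_vector \<Rightarrow> real) \<Rightarrow> ('b \<Rightarrow> 'b) \<Rightarrow> real \<Rightarrow> bool" where
  "descent_cond L gradL \<alpha> \<longleftrightarrow> (\<forall>f. D_loss L f (gradL f) \<ge> \<alpha> * (norm (gradL f))\<^sup>2)"

definition compat_cond ::
  "('b::real_normed_vector \<Rightarrow> real) \<Rightarrow> ('b \<Rightarrow> 'b) \<Rightarrow> real \<Rightarrow> bool" where
  "compat_cond L gradL \<beta> \<longleftrightarrow> (\<forall>f. onorm (D_loss L f) \<le> \<beta> * norm (gradL f))"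

definition PL_cond :: "('b::real_normed_vector \<Rightarrow> real) \<Rightarrow> real \<Rightarrow> real \<Rightarrow> bool" where
  "PL_cond L Lstar \<mu> \<longleftrightarrow> (\<forall>f. L f - Lstar \<le> 1 / (2 * \<mu>) * (onorm (D_loss L f))\<^sup>2)"

text \<open>The Hilbert space is a type \<open>'h\<close> with its own inner product and norm; its inclusion
  into the Banach space is the injective linear map \<open>\<iota>\<close>, which is not assumed continuous.
  \<open>loss\<close> and \<open>grad\<close> are the loss and its Riesz gradient on the Hilbert space, \<open>L\<close> and \<open>gradL\<close>
  their extensions.\<close>

definition extended_loss ::
  "('h::{real_inner, complete_space} \<Rightarrow> 'b::banach) \<Rightarrow> ('h \<Rightarrow> real) \<Rightarrow> ('h \<Rightarrow> 'h)
     \<Rightarrow> ('b \<Rightarrow> real) \<Rightarrow> ('b \<Rightarrow> 'b) \<Rightarrow> bool" where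
  "extended_loss \<iota> loss grad L gradL \<longleftrightarrow>
     linear \<iota> \<and> inj \<iota> \<and>
     (\<forall>h. GDERIV loss h :> grad h) \<and>
     (\<forall>f. L differentiable (at f)) \<and>
     (\<forall>h. L (\<iota> h) = loss h) \<and>
     (\<forall>h. gradL (\<iota> h) = \<iota> (grad h))"

end

theory Submission
  imports Defs
begin

text \<open>With \<open>\<rho> = \<epsilon> / (1 - \<epsilon>) \<le> 1\<close> the relative error bound gives
  \<open>norm (g - \<nabla>L f) \<le> \<rho> norm (\<nabla>L f)\<close>, hence \<open>norm g \<le> (1 + \<rho>) norm (\<nabla>L f)\<close>, and
  \<open>(1 + \<rho>)\<^sup>2 \<le> 1 + 3 \<rho>\<close>. Inserting this into the smoothness inequality along the step, one gets
  a decrease of at least \<open>\<eta> r (norm (\<nabla>L f))\<^sup>2\<close>, which the compatibility and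
  Polyak--Lojasiewicz inequalities bound below by a multiple of \<open>L f - L\<^sup>\<star>\<close>.\<close>

lemma rel_err_le_imp_norm_le:
  assumes "rel_err g d \<le> ereal \<epsilon>"
  shows "norm (g - d) \<le> \<epsilon> * norm g"
  \<comment> \<open>A real bound excludes the value \<open>\<infinity>\<close>, so
    \<open>g = 0\<close> forces \<open>d = 0\<close> and the claim degenerates to
    \<open>0 \<le> 0\<close>.\<close>
  using assms by (auto simp: rel_err_def divide_simps mult.commute split: if_splits)

text \<open>The triangle inequality bounds \<open>norm g\<close> by \<open>norm d\<close> plus the
  error; for \<open>\<epsilon> < 1\<close> the error term is absorbed on the left. This trades an
  error relative to \<open>g\<close> for one relative to the exact gradient.\<close>

lemma norm_error_le:
  fixes g d :: "'b::real_normed_vector"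
  assumes err: "norm (g - d) \<le> \<epsilon> * norm g" and "0 \<le> \<epsilon>" "\<epsilon> < 1"
  shows "norm (g - d) \<le> \<epsilon> / (1 - \<epsilon>) * norm d"
proof -
  have "norm g \<le> norm d + norm (g - d)"
    using norm_triangle_sub[of g d] by simp
  then have "\<epsilon> * norm g \<le> \<epsilon> * (norm d + norm (g - d))"
    using \<open>0 \<le> \<epsilon>\<close> by (rule mult_left_mono)
  with err have "norm (g - d) * (1 - \<epsilon>) \<le> \<epsilon> * norm d"
    by (simp add: algebra_simps)
  with \<open>\<epsilon> < 1\<close> show ?thesis
    by (simp add: field_simps)
qed

text \<open>With \<open>\<rho> = \<epsilon> / (1 - \<epsilon>)\<close> the bracket is exactly
  \<open>r\<close>; keeping \<open>\<rho>\<close> abstract leaves every estimate polynomial in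
  \<open>\<rho>\<close>.\<close>

lemma gradient_step_decrease:
  fixes L :: "'b::real_normed_vector \<Rightarrow> real"
  assumes diff: "L differentiable (at x)"
    and smooth: "smooth_cond L K" and descent: "descent_cond L gradL \<alpha>"
    and compat: "compat_cond L gradL \<beta>"
    and "K \<ge> 0" "\<beta> \<ge> 0" "\<eta> \<ge> 0" "0 \<le> \<rho>" "\<rho> \<le> 1"
    and err: "norm (g - gradL x) \<le> \<rho> * norm (gradL x)"
  shows "L (x - \<eta> *\<^sub>R g)
    \<le> L x - \<eta> * (\<alpha> - K * \<eta> / 2 - (\<beta> + 3 / 2 * K * \<eta>) * \<rho>) * (norm (gradL x))\<^sup>2"
proof -
  let ?D = "D_loss L x" and ?d = "gradL x"
  let ?G = "norm ?d"
  have bl: "bounded_linear ?D"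
    using diff by (auto intro: has_derivative_bounded_linear simp: frechet_derivative_works)
  \<comment> \<open>The error may point anywhere, so its pairing with the derivative is controlled
    only through the dual norm, which compatibility compares with the gradient norm.\<close>
  have "- ?D (g - ?d) \<le> onorm ?D * norm (g - ?d)"
    using onorm[OF bl, of "g - ?d"] by simp
  also have "\<dots> \<le> (\<beta> * ?G) * (\<rho> * ?G)"
    using compat err onorm_pos_le[OF bl] \<open>\<beta> \<ge> 0\<close>
    by (intro mult_mono) (auto simp: compat_cond_def)
  finally have De: "- ?D (g - ?d) \<le> \<beta> * \<rho> * ?G\<^sup>2"
    by (simp add: power2_eq_square algebra_simps)
  have "?D g = ?D ?d + ?D (g - ?d)"
    using linear_add[OF bounded_linear.linear[OF bl], of ?d "g - ?d"] by simp
  moreover have "?D ?d \<ge> \<alpha> * ?G\<^sup>2"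
    using descent by (simp add: descent_cond_def)
  ultimately have Dg: "?D g \<ge> (\<alpha> - \<beta> * \<rho>) * ?G\<^sup>2"
    using De by (simp add: left_diff_distrib)
  have "norm g \<le> ?G + norm (g - ?d)"
    using norm_triangle_sub[of g ?d] by simp
  with err have "norm g \<le> (1 + \<rho>) * ?G"
    by (simp add: algebra_simps)
  then have "(norm g)\<^sup>2 \<le> ((1 + \<rho>) * ?G)\<^sup>2"
    by (rule power_mono) simp
  also have "\<dots> = (1 + \<rho>)\<^sup>2 * ?G\<^sup>2"
    by (simp add: power_mult_distrib)
  \<comment> \<open>Here \<open>\<rho> \<le> 1\<close> gives
    \<open>\<rho> * \<rho> \<le> \<rho>\<close>. The resulting 3, halved by the factor
    \<open>K / 2\<close>, is the source of \<open>3 / 2 * K * \<eta>\<close> in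
    \<open>r\<close>.\<close>
  also have "\<dots> \<le> (1 + 3 * \<rho>) * ?G\<^sup>2"
    using mult_left_mono[OF \<open>\<rho> \<le> 1\<close> \<open>0 \<le> \<rho>\<close>]
    by (intro mult_right_mono) (auto simp: power2_eq_square algebra_simps)
  finally have ng: "(norm g)\<^sup>2 \<le> (1 + 3 * \<rho>) * ?G\<^sup>2" .
  have "L (x - \<eta> *\<^sub>R g) \<le> L x + ?D (- (\<eta> *\<^sub>R g)) + K / 2 * (norm (\<eta> *\<^sub>R g))\<^sup>2"
    using smooth[unfolded smooth_cond_def, rule_format, of "x - \<eta> *\<^sub>R g" x] by simp
  also have "?D (- (\<eta> *\<^sub>R g)) = - (\<eta> * ?D g)"
    using linear_cmul[OF bounded_linear.linear[OF bl], of "- \<eta>" g] by simp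
  also have "K / 2 * (norm (\<eta> *\<^sub>R g))\<^sup>2 = K / 2 * \<eta>\<^sup>2 * (norm g)\<^sup>2"
    by (simp add: power_mult_distrib)
  also have "L x + - (\<eta> * ?D g) + K / 2 * \<eta>\<^sup>2 * (norm g)\<^sup>2
      \<le> L x + - (\<eta> * ((\<alpha> - \<beta> * \<rho>) * ?G\<^sup>2)) + K / 2 * \<eta>\<^sup>2 * ((1 + 3 * \<rho>) * ?G\<^sup>2)"
    using Dg ng \<open>K \<ge> 0\<close> \<open>\<eta> \<ge> 0\<close>
    by (intro add_mono le_imp_neg_le mult_left_mono) auto
  also have "\<dots> = L x - \<eta> * (\<alpha> - K * \<eta> / 2 - (\<beta> + 3 / 2 * K * \<eta>) * \<rho>) * ?G\<^sup>2"
    by (simp add: power2_eq_square field_simps)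
  finally show ?thesis .
qed

text \<open>Compatibility replaces the dual norm in the PL inequality by the gradient norm, turning
  a decrease measured by the gradient into one proportional to the optimality gap.\<close>

lemma PL_compat_imp_gradient_lower_bound:
  fixes L :: "'b::real_normed_vector \<Rightarrow> real"
  assumes diff: "L differentiable (at x)"
    and compat: "compat_cond L gradL \<beta>" and PL: "PL_cond L Lstar \<mu>"
    and "\<beta> > 0" "\<mu> > 0"
  shows "2 * inverse (\<beta>\<^sup>2) * \<mu> * (L x - Lstar) \<le> (norm (gradL x))\<^sup>2"
proof -
  have bl: "bounded_linear (D_loss L x)"
    using diff by (auto intro: has_derivative_bounded_linear simp: frechet_derivative_works)
  have "(onorm (D_loss L x))\<^sup>2 \<le> (\<beta> * norm (gradL x))\<^sup>2"
    using compat onorm_pos_le[OF bl] by (intro power_mono) (auto simp: compat_cond_def)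
  then have "1 / (2 * \<mu>) * (onorm (D_loss L x))\<^sup>2 \<le> 1 / (2 * \<mu>) * (\<beta> * norm (gradL x))\<^sup>2"
    using \<open>\<mu> > 0\<close> by (intro mult_left_mono) auto
  with PL have "L x - Lstar \<le> 1 / (2 * \<mu>) * (\<beta> * norm (gradL x))\<^sup>2"
    unfolding PL_cond_def by (meson order_trans)
  with \<open>\<mu> > 0\<close> \<open>\<beta> > 0\<close> show ?thesis
    by (simp add: field_simps power_mult_distrib)
qed

text \<open>The factor \<open>c\<close> may be negative; then nonnegativity of the sequence forces it to vanish.\<close>

lemma nonneg_geometric_bound:
  fixes a :: "nat \<Rightarrow> real"
  assumes nonneg: "\<And>t. a t \<ge> 0" and step: "\<And>t. t < T \<Longrightarrow> a (Suc t) \<le> c * a t"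
  shows "a T \<le> c ^ T * a 0"
proof (cases "c \<ge> 0")
  case True
  have "t \<le> T \<Longrightarrow> a t \<le> c ^ t * a 0" for t
  proof (induction t)
    case (Suc t)
    have "a (Suc t) \<le> c * a t"
      using Suc.prems by (intro step) simp
    also have "\<dots> \<le> c * (c ^ t * a 0)"
      using Suc True by (intro mult_left_mono) auto
    finally show ?case by (simp add: mult.assoc)
  qed simp
  then show ?thesis by simp
next
  case False
  have zero: "a t = 0" if "t < T" for t
  proof -
    \<comment> \<open>Since \<open>0 \<le> a (Suc t) \<le> c * a t\<close> with
      \<open>c < 0\<close>, the value \<open>a t\<close> cannot be positive.\<close>
    have "0 \<le> c * a t"
      using step[OF that] nonneg[of "Suc t"] by linarith
    with False nonneg[of t] show ?thesis
      by (auto simp: zero_le_mult_iff)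
  qed
  show ?thesis
  proof (cases T)
    case (Suc t)
    then show ?thesis using step[of t] zero[of t] zero[of 0] by simp
  qed simp
qed

theorem proposition3p8:
  fixes \<iota> :: "'h::{real_inner, complete_space} \<Rightarrow> 'b::banach"
    and loss :: "'h \<Rightarrow> real" and grad :: "'h \<Rightarrow> 'h"
    and L :: "'b \<Rightarrow> real" and gradL :: "'b \<Rightarrow> 'b"
    and K \<alpha> \<beta> \<mu> Lstar \<eta> \<epsilon> r :: real
    and T :: nat and f g :: "nat \<Rightarrow> 'b"
  assumes "extended_loss \<iota> loss grad L gradL"
    and "K > 0" and "\<alpha> > 0" and "\<beta> > 0" and "\<mu> > 0"
    and "bdd_below (range (\<lambda>h. L (\<iota> h)))"
    and "Lstar = (INF h. L (\<iota> h))"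
    and "smooth_cond L K"
    and "descent_cond L gradL \<alpha>"
    and "compat_cond L gradL \<beta>"
    and "PL_cond L Lstar \<mu>"
    and "\<And>x. L x \<ge> Lstar"
    and "T \<ge> 1" and "\<eta> > 0"
    and "\<And>t. t < T \<Longrightarrow> f (Suc t) = f t - \<eta> *\<^sub>R g t"
    and "0 \<le> \<epsilon>" and "\<epsilon> < min (1 / 2) (\<alpha> / (\<alpha> + \<beta>))"
    and "\<And>t. t < T \<Longrightarrow> rel_err (g t) (gradL (f t)) \<le> ereal \<epsilon>"
    and "\<eta> < 2 * (\<alpha> - (\<alpha> + \<beta>) * \<epsilon>) / (K * (2 * \<epsilon> + 1))"
    and "r = \<alpha> - K * \<eta> / 2 - (\<beta> + 3 / 2 * K * \<eta>) * (\<epsilon> / (1 - \<epsilon>))"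
  shows "r > 0 \<and>
    L (f T) - Lstar \<le> (1 - 2 * \<eta> * inverse (\<beta>\<^sup>2) * \<mu> * r) ^ T * (L (f 0) - Lstar)"
proof -
  have diff: "L differentiable (at x)" for x
    using assms(1) by (simp add: extended_loss_def)
  define \<rho> where "\<rho> = \<epsilon> / (1 - \<epsilon>)"
  define c where "c = 1 - 2 * \<eta> * inverse (\<beta>\<^sup>2) * \<mu> * r"
  have eps: "\<epsilon> < 1 / 2"
    using \<open>\<epsilon> < min (1 / 2) (\<alpha> / (\<alpha> + \<beta>))\<close> by simp
  have rho: "0 \<le> \<rho>" "\<rho> \<le> 1"
    using eps \<open>0 \<le> \<epsilon>\<close> by (auto simp: \<rho>_def field_simps)
  have "\<eta> * (K * (2 * \<epsilon> + 1)) < 2 * (\<alpha> - (\<alpha> + \<beta>) * \<epsilon>)"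
    using \<open>\<eta> < 2 * (\<alpha> - (\<alpha> + \<beta>) * \<epsilon>) / (K * (2 * \<epsilon> + 1))\<close> \<open>K > 0\<close> \<open>0 \<le> \<epsilon>\<close>
    by (subst (asm) pos_less_divide_eq) auto
  \<comment> \<open>Doubling and collecting terms gives \<open>2 * (\<alpha> - (\<alpha> + \<beta>)
    * \<epsilon>) - \<eta> * K * (2 * \<epsilon> + 1)\<close>, so the learning rate bound is
    precisely positivity of \<open>r\<close>.\<close>
  moreover have "r * (1 - \<epsilon>) = (\<alpha> - K * \<eta> / 2) * (1 - \<epsilon>) - (\<beta> + 3 / 2 * K * \<eta>) * \<epsilon>"
    using eps unfolding \<open>r = _\<close> by (simp add: left_diff_distrib)
  ultimately have "r * (1 - \<epsilon>) > 0"
    by (simp add: field_simps)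
  then have "r > 0"
    using eps by (simp add: zero_less_mult_iff)
  have "L (f (Suc t)) - Lstar \<le> c * (L (f t) - Lstar)" if t: "t < T" for t
  proof -
    have "norm (g t - gradL (f t)) \<le> \<rho> * norm (gradL (f t))"
      unfolding \<rho>_def using assms(18)[OF t] eps \<open>0 \<le> \<epsilon>\<close>
      by (intro norm_error_le rel_err_le_imp_norm_le) auto
    then have "L (f t - \<eta> *\<^sub>R g t) \<le> L (f t) - \<eta> * r * (norm (gradL (f t)))\<^sup>2"
      using gradient_step_decrease[OF diff \<open>smooth_cond L K\<close> \<open>descent_cond L gradL \<alpha>\<close>
          \<open>compat_cond L gradL \<beta>\<close> _ _ _ rho]
        \<open>K > 0\<close> \<open>\<beta> > 0\<close> \<open>\<eta> > 0\<close>
      by (simp add: \<open>r = _\<close> \<rho>_def)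
    moreover have "\<eta> * r * (2 * inverse (\<beta>\<^sup>2) * \<mu> * (L (f t) - Lstar))
        \<le> \<eta> * r * (norm (gradL (f t)))\<^sup>2"
      using PL_compat_imp_gradient_lower_bound[OF diff \<open>compat_cond L gradL \<beta>\<close>
          \<open>PL_cond L Lstar \<mu>\<close> \<open>\<beta> > 0\<close> \<open>\<mu> > 0\<close>] \<open>r > 0\<close> \<open>\<eta> > 0\<close>
      by (intro mult_left_mono) auto
    ultimately show ?thesis
      unfolding assms(15)[OF t] by (simp add: c_def algebra_simps)
  qed
  \<comment> \<open>The gaps are nonnegative because \<open>Lstar\<close> bounds \<open>L\<close>
    below on the whole Banach space, where the iterates live, and not only on the image of
    \<open>\<iota>\<close>.\<close>
  then have "L (f T) - Lstar \<le> c ^ T * (L (f 0) - Lstar)"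
    using \<open>\<And>x. L x \<ge> Lstar\<close>
    by (intro nonneg_geometric_bound[where a = "\<lambda>t. L (f t) - Lstar"]) auto
  with \<open>r > 0\<close> show ?thesis
    by (simp add: c_def)
qed

end
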